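(* Let $(X,d_X)$ and $(Y,d_Y)$ be $g$-quasi metric spaces of the same index $r$, and let $d_{XY}$ be the product $g$-quasi metric on $X\times Y$. If $(X\times Y,d_{XY})$ is weak $G$-complete, then $(X,d_X)$ and $(Y,d_Y)$ are weak $G$-complete.
   Context: A $g$-quasi metric of index $r\ge 0$ on a nonempty set $X$ is a mapping $d:X\times X\to\mathbb R$ such that (a) for all $x,y\in X$, $d(x,y)\ge r$, and $d(x,y)=r\iff x=y$; (b) for all $x,y,z\in X$, $d(x,y)\le d(x,z)+d(z,y)$. (Symmetry is not assumed.) The pair $(X,d)$ is then a $g$-quasi metric space of index $r$. For $x\in X$ and $p>0$ let $B_d(x,p)=\{y\in X: d(x,y)<p\}$. The induced generalized topology $\mu(d)$ is the collection of all unions of members of $\{B_d(x,p):x\in X,\ p>0\}\cup\{\emptyset\}$ (it need not be closed under finite intersections). For $g$-quasi metric spaces $(X,d_X)$, $(Y,d_Y)$ of the same index $r$, the product $g$-quasi metric $d_{XY}$ on $X\times Y$ (again of index $r$) is $d_{XY}((x_1,y_1),(x_2,y_2))=\max\{d_X(x_1,x_2),d_Y(y_1,y_2)\}$. A point $c\in X$ is a cluster point of a sequence $(x_n)$ in $(X,d)$ if it is so in $(X,\mu(d))$, i.e. for every $V\in\mu(d)$ with $c\in V$ and every $k\in\mathbb N$ there is $n\ge k$ with $x_n\in V$. A sequence $(x_n)$ in a $g$-quasi metric space $(X,d)$ of index $r$ is $G$-Cauchy if for every $\epsilon>r$ there exists $k\in\mathbb N$ such that $d(x_n,x_{n+1})<\epsilon$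 for all $n\ge k$. $(X,d)$ is weak $G$-complete if every $G$-Cauchy sequence in it has a cluster point in $X$. *)

theory Defs
  imports Complex_Main
begin

definition g_quasi_metric_space :: "real \<Rightarrow> 'a set \<Rightarrow> ('a \<Rightarrow> 'a \<Rightarrow> real) \<Rightarrow> bool" where
  "g_quasi_metric_space r X d \<longleftrightarrow>
     r \<ge> 0 \<and> X \<noteq> {} \<and>
     (\<forall>x\<in>X. \<forall>y\<in>X. d x y \<ge> r \<and> (d x y = r \<longleftrightarrow> x = y)) \<and>
     (\<forall>x\<in>X. \<forall>y\<in>X. \<forall>z\<in>X. d x y \<le> d x z + d z y)"

definition gq_ball :: "'a set \<Rightarrow> ('a \<Rightarrow> 'a \<Rightarrow> real) \<Rightarrow> 'a \<Rightarrow> real \<Rightarrow> 'a set" where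
  "gq_ball X d x p = {y \<in> X. d x y < p}"

(* A plain family of sets rather than a value of type 'a topology:
   it need not be closed under finite intersections. *)
definition gq_topology :: "'a set \<Rightarrow> ('a \<Rightarrow> 'a \<Rightarrow> real) \<Rightarrow> 'a set set" where
  "gq_topology X d =
     {\<Union>\<U> | \<U>. \<U> \<subseteq> {gq_ball X d x p | x p. x \<in> X \<and> p > 0} \<union> {{}}}"

definition prod_gq_metric ::
  "('a \<Rightarrow> 'a \<Rightarrow> real) \<Rightarrow> ('b \<Rightarrow> 'b \<Rightarrow> real) \<Rightarrow> 'a \<times> 'b \<Rightarrow> 'a \<times> 'b \<Rightarrow> real" where
  "prod_gq_metric dX dY = (\<lambda>(x1, y1) (x2, y2). max (dX x1 x2) (dY y1 y2))"

definition cluster_point :: "'a set set \<Rightarrow> (nat \<Rightarrow> 'a) \<Rightarrow> 'a \<Rightarrow> bool" where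
  "cluster_point \<mu> s c \<longleftrightarrow> (\<forall>V\<in>\<mu>. c \<in> V \<longrightarrow> (\<forall>k. \<exists>n\<ge>k. s n \<in> V))"

definition G_Cauchy :: "real \<Rightarrow> 'a set \<Rightarrow> ('a \<Rightarrow> 'a \<Rightarrow> real) \<Rightarrow> (nat \<Rightarrow> 'a) \<Rightarrow> bool" where
  "G_Cauchy r X d s \<longleftrightarrow>
     range s \<subseteq> X \<and> (\<forall>\<epsilon>>r. \<exists>k. \<forall>n\<ge>k. d (s n) (s (Suc n)) < \<epsilon>)"

definition weak_G_complete :: "real \<Rightarrow> 'a set \<Rightarrow> ('a \<Rightarrow> 'a \<Rightarrow> real) \<Rightarrow> bool" where
  "weak_G_complete r X d \<longleftrightarrow>
     (\<forall>s. G_Cauchy r X d s \<longrightarrow> (\<exists>c\<in>X. cluster_point (gq_topology X d) s c))"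

lemma g_quasi_metric_space_prod:
  assumes "g_quasi_metric_space r X dX" and "g_quasi_metric_space r Y dY"
  shows "g_quasi_metric_space r (X \<times> Y) (prod_gq_metric dX dY)"
proof -
  have X: "r \<ge> 0" "X \<noteq> {}" "\<And>x y. x \<in> X \<Longrightarrow> y \<in> X \<Longrightarrow> dX x y \<ge> r"
    "\<And>x y. x \<in> X \<Longrightarrow> y \<in> X \<Longrightarrow> dX x y = r \<longleftrightarrow> x = y"
    "\<And>x y z. x \<in> X \<Longrightarrow> y \<in> X \<Longrightarrow> z \<in> X \<Longrightarrow> dX x y \<le> dX x z + dX z y"
    using assms(1) unfolding g_quasi_metric_space_def by blast+
  have Y: "Y \<noteq> {}" "\<And>x y. x \<in> Y \<Longrightarrow> y \<in> Y \<Longrightarrow> dY x y \<ge> r"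
    "\<And>x y. x \<in> Y \<Longrightarrow> y \<in> Y \<Longrightarrow> dY x y = r \<longleftrightarrow> x = y"
    "\<And>x y z. x \<in> Y \<Longrightarrow> y \<in> Y \<Longrightarrow> z \<in> Y \<Longrightarrow> dY x y \<le> dY x z + dY z y"
    using assms(2) unfolding g_quasi_metric_space_def by blast+
  have "max (dX a a') (dY b b') \<ge> r \<and> (max (dX a a') (dY b b') = r \<longleftrightarrow> a = a' \<and> b = b')"
    if "a \<in> X" "a' \<in> X" "b \<in> Y" "b' \<in> Y" for a a' b b'
    using X(3)[of a a'] X(4)[of a a'] Y(2)[of b b'] Y(3)[of b b'] that
    by (smt (verit))
  moreover have "max (dX a a') (dY b b') \<le> max (dX a a'') (dY b b'') + max (dX a'' a') (dY b'' b')"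
    if "a \<in> X" "a' \<in> X" "a'' \<in> X" "b \<in> Y" "b' \<in> Y" "b'' \<in> Y" for a a' a'' b b' b''
    using X(5)[of a a' a''] Y(4)[of b b' b''] that by linarith
  ultimately show ?thesis
    using X(1,2) Y(1) unfolding g_quasi_metric_space_def prod_gq_metric_def by auto
qed

end

theory Submission
  imports Defs
begin

text \<open>
  Each factor is the image of the product under a projection, and each factor embeds
  isometrically into the product as a slice \<open>X \<times> {b}\<close>. A \<open>G\<close>-Cauchy sequence in \<open>X\<close> therefore
  lifts to a \<open>G\<close>-Cauchy sequence in the slice, which has a cluster point \<open>(c, y)\<close> in the
  product, and \<open>c\<close> is a cluster point of the original sequence.

  The delicate point is that the generalized topology is generated by balls whose centre need
  not be the cluster point: a ball around \<open>a\<close> containing \<open>c\<close> need not contain any nonempty ball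
  around \<open>c\<close> when \<open>r > 0\<close>. So balls with arbitrary centre have to be lifted. If \<open>d(a, c) < p\<close>, the product
  ball of radius \<open>p\<close> around \<open>(a, y)\<close> projects into the ball around \<open>a\<close>, and it contains
  \<open>(c, y)\<close> because the second coordinate contributes only \<open>d(y, y) = r \<le> d(a, c)\<close>.

  The lemma \<open>weak_G_complete_retract\<close> isolates the two properties of a projection that this uses
  (an isometric section, and the lifting of centres), so that it applies to both factors.
\<close>

lemma cluster_point_gq_topology_iff:
  assumes "c \<in> X"
  shows "cluster_point (gq_topology X d) s c \<longleftrightarrow>
    (\<forall>a\<in>X. \<forall>p>0. d a c < p \<longrightarrow> (\<forall>k. \<exists>n\<ge>k. s n \<in> gq_ball X d a p))"
    (is "_ \<longleftrightarrow> ?balls")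
proof
  assume cl: "cluster_point (gq_topology X d) s c"
  show ?balls
  proof (intro ballI allI impI)
    fix a p k
    assume "a \<in> X" "(0::real) < p" "d a c < p"
    then have "\<Union>{gq_ball X d a p} \<in> gq_topology X d"
      unfolding gq_topology_def by blast
    moreover have "c \<in> gq_ball X d a p"
      using \<open>d a c < p\<close> assms by (simp add: gq_ball_def)
    ultimately show "\<exists>n\<ge>k. s n \<in> gq_ball X d a p"
      using cl unfolding cluster_point_def by simp
  qed
next
  assume balls: ?balls
  show "cluster_point (gq_topology X d) s c"
    unfolding cluster_point_def
  proof (intro ballI impI allI)
    fix V k
    assume "V \<in> gq_topology X d" "c \<in> V"
    then obtain a p where "a \<in> X" "p > 0" "c \<in> gq_ball X d a p" "gq_ball X d a p \<subseteq> V"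
      unfolding gq_topology_def by blast
    then show "\<exists>n\<ge>k. s n \<in> V"
      using balls unfolding gq_ball_def by blast
  qed
qed

text \<open>
  The section \<open>g\<close> carries \<open>G\<close>-Cauchy sequences of \<open>X\<close> to \<open>Z\<close>, and the retraction \<open>f\<close> carries
  cluster points back. For the latter, a ball around \<open>a\<close> containing \<open>f z\<close> is compared with the ball
  of the same radius around the centre \<open>w\<close> supplied by the last hypothesis: that ball still
  contains \<open>z\<close>, and \<open>f\<close> maps it into the ball around \<open>a\<close>.
\<close>

lemma weak_G_complete_retract:
  assumes complete: "weak_G_complete r Z dZ"
    and f: "f ` Z \<subseteq> X" and g: "g ` X \<subseteq> Z"
    and fg: "\<And>x. x \<in> X \<Longrightarrow> f (g x) = x"
    and iso: "\<And>x x'. \<lbrakk>x \<in> X; x' \<in> X\<rbrakk> \<Longrightarrow> dZ (g x) (g x') = dX x x'"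
    and lift_centre: "\<And>a z. \<lbrakk>a \<in> X; z \<in> Z\<rbrakk> \<Longrightarrow>
      \<exists>w\<in>Z. dZ w z \<le> dX a (f z) \<and> (\<forall>z'\<in>Z. dX a (f z') \<le> dZ w z')"
  shows "weak_G_complete r X dX"
  unfolding weak_G_complete_def
proof (intro allI impI)
  fix s
  assume cauchy: "G_Cauchy r X dX s"
  then have s: "s n \<in> X" for n
    unfolding G_Cauchy_def by blast
  have "range (g \<circ> s) \<subseteq> Z"
    using s g by auto
  then have "G_Cauchy r Z dZ (g \<circ> s)"
    using cauchy s iso unfolding G_Cauchy_def by simp
  then obtain z where z: "z \<in> Z" "cluster_point (gq_topology Z dZ) (g \<circ> s) z"
    using complete unfolding weak_G_complete_def by blast
  have fz: "f z \<in> X"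
    using z(1) f by blast
  have "\<exists>n\<ge>k. s n \<in> gq_ball X dX a p" if "a \<in> X" "0 < p" "dX a (f z) < p" for a p k
  proof -
    obtain w where w: "w \<in> Z" "dZ w z \<le> dX a (f z)" "\<forall>z'\<in>Z. dX a (f z') \<le> dZ w z'"
      using lift_centre[OF \<open>a \<in> X\<close> z(1)] by blast
    have "dZ w z < p"
      using w(2) that(3) by simp
    then obtain n where n: "n \<ge> k" "(g \<circ> s) n \<in> gq_ball Z dZ w p"
      using z w(1) \<open>0 < p\<close> cluster_point_gq_topology_iff[OF z(1)] by blast
    have "dX a (s n) \<le> dZ w (g (s n))"
      using w(3) s[of n] g fg by (metis image_subset_iff)
    then have "s n \<in> gq_ball X dX a p"
      using n(2) s[of n] by (simp add: gq_ball_def)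
    then show ?thesis
      using n(1) by blast
  qed
  then have "cluster_point (gq_topology X dX) s (f z)"
    using cluster_point_gq_topology_iff[OF fz] by blast
  then show "\<exists>c\<in>X. cluster_point (gq_topology X dX) s c"
    using fz by blast
qed

theorem theorem5p11:
  fixes r :: real
    and X :: "'a set" and dX :: "'a \<Rightarrow> 'a \<Rightarrow> real"
    and Y :: "'b set" and dY :: "'b \<Rightarrow> 'b \<Rightarrow> real"
  assumes "g_quasi_metric_space r X dX"
    and "g_quasi_metric_space r Y dY"
    and "weak_G_complete r (X \<times> Y) (prod_gq_metric dX dY)"
  shows "weak_G_complete r X dX \<and> weak_G_complete r Y dY"
proof -
  have X: "\<And>x x'. \<lbrakk>x \<in> X; x' \<in> X\<rbrakk> \<Longrightarrow> r \<le> dX x x'" "\<And>x. x \<in> X \<Longrightarrow> dX x x = r"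
    using assms(1) unfolding g_quasi_metric_space_def by blast+
  have Y: "\<And>y y'. \<lbrakk>y \<in> Y; y' \<in> Y\<rbrakk> \<Longrightarrow> r \<le> dY y y'" "\<And>y. y \<in> Y \<Longrightarrow> dY y y = r"
    using assms(2) unfolding g_quasi_metric_space_def by blast+
  obtain a b where a: "a \<in> X" and b: "b \<in> Y"
    using assms(1,2) unfolding g_quasi_metric_space_def by blast
  have "weak_G_complete r X dX"
  proof (rule weak_G_complete_retract[OF assms(3), where f = fst and g = "\<lambda>x. (x, b)"])
    fix x z
    assume "x \<in> X" "z \<in> X \<times> Y"
    then show "\<exists>w\<in>X \<times> Y. prod_gq_metric dX dY w z \<le> dX x (fst z) \<and>
        (\<forall>z'\<in>X \<times> Y. dX x (fst z') \<le> prod_gq_metric dX dY w z')"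
      using X(1) Y(2) by (intro bexI[of _ "(x, snd z)"]) (auto simp: prod_gq_metric_def)
  qed (use X(1) Y(2) b in \<open>auto simp: prod_gq_metric_def max_def intro: antisym\<close>)
  moreover have "weak_G_complete r Y dY"
  proof (rule weak_G_complete_retract[OF assms(3), where f = snd and g = "\<lambda>y. (a, y)"])
    fix y z
    assume "y \<in> Y" "z \<in> X \<times> Y"
    then show "\<exists>w\<in>X \<times> Y. prod_gq_metric dX dY w z \<le> dY y (snd z) \<and>
        (\<forall>z'\<in>X \<times> Y. dY y (snd z') \<le> prod_gq_metric dX dY w z')"
      using Y(1) X(2) by (intro bexI[of _ "(fst z, y)"]) (auto simp: prod_gq_metric_def)
  qed (use Y(1) X(2) a in \<open>auto simp: prod_gq_metric_def max_def intro: antisym\<close>)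
  ultimately show ?thesis ..
qed

end
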